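(* Let $n\ge 3$ and let $f\in\mathrm{Per}(\mathbb{F}_2^n)\setminus \mathrm{AGL}(n,\mathbb{F}_2)$. Then \[2\text{-coaffinity}(f)\ge \tfrac{8}{3}(2^{n-1}-1)(2^{n-2}-1).\] Moreover, letting $\tau\in\mathrm{Per}(\mathbb{F}_2^n)$ be any transposition, equality holds if and only if $f\in \mathrm{AGL}(n,\mathbb{F}_2)\circ\tau\circ\mathrm{AGL}(n,\mathbb{F}_2)$.
   Context: $\mathrm{Per}(\mathbb{F}_2^n)$ is the group of all permutations of $\mathbb{F}_2^n$, and $\mathrm{AGL}(n,\mathbb{F}_2)$ is the group of invertible affine maps $x\mapsto xA+b$ ($A\in\mathrm{GL}(n,\mathbb{F}_2)$, $b\in\mathbb{F}_2^n$). A $2$-flat of $\mathbb{F}_2^n$ is a coset of a $2$-dimensional linear subspace (equivalently a 4-element set $\{x_1,x_2,x_3,x_4\}$ with $x_1+x_2+x_3+x_4=0$). For $f\in\mathrm{Per}(\mathbb{F}_2^n)$, $2\text{-coaffinity}(f)$ is the number of $2$-flats $X$ such that $f(X)$ is not a $2$-flat. A transposition is a permutation interchanging two distinct points and fixing all others. $\mathrm{AGL}\circ\tau\circ\mathrm{AGL}$ denotes $\{\alpha\circ\tau\circ\beta:\alpha,\beta\in\mathrm{AGL}(n,\mathbb{F}_2)\}$. *)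

theory Defs
  imports
    "HOL-Analysis.Analysis"
    "HOL-Library.Z2"
    "HOL-Combinatorics.Transposition"
begin

text \<open>The field with two elements is \<^typ>\<open>bit\<close>; its finiteness makes \<^typ>\<open>bit ^ 'n\<close> a finite
  type, so that the \<^const>\<open>card\<close> in the definition of the coaffinity is a genuine count.\<close>

instance bit :: finite
proof
  have "(UNIV :: bit set) \<subseteq> {0, 1}"
    by (auto intro: bit_not_one_iff[THEN iffD1])
  then show "finite (UNIV :: bit set)"
    by (rule finite_subset) simp
qed

definition Per :: "(bit ^ 'n \<Rightarrow> bit ^ 'n) set" where
  "Per = {f. bij f}"

definition AGL :: "(bit ^ 'n \<Rightarrow> bit ^ 'n) set" where
  "AGL = {f. \<exists>(A :: bit ^ 'n ^ 'n) b. invertible A \<and> f = (\<lambda>x. x v* A + b)}"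

definition two_flat :: "(bit ^ 'n) set \<Rightarrow> bool" where
  "two_flat X \<longleftrightarrow> (\<exists>a V. vec.subspace V \<and> vec.dim V = 2 \<and> X = (\<lambda>v. a + v) ` V)"

definition two_coaffinity :: "(bit ^ 'n \<Rightarrow> bit ^ 'n) \<Rightarrow> nat" where
  "two_coaffinity f = card {X. two_flat X \<and> \<not> two_flat (f ` X)}"

text \<open>The name is qualified because \<open>transpose\<close> alone also denotes matrix transposition.\<close>

definition is_transposition :: "('a \<Rightarrow> 'a) \<Rightarrow> bool" where
  "is_transposition \<tau> \<longleftrightarrow> (\<exists>a b. a \<noteq> b \<and> \<tau> = Transposition.transpose a b)"

definition AGL_double_coset :: "(bit ^ 'n \<Rightarrow> bit ^ 'n) \<Rightarrow> (bit ^ 'n \<Rightarrow> bit ^ 'n) set" where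
  "AGL_double_coset \<tau> = {\<alpha> \<circ> \<tau> \<circ> \<beta> | \<alpha> \<beta>. \<alpha> \<in> AGL \<and> \<beta> \<in> AGL}"

end

theory Submission
  imports Defs
begin

text \<open>Put \<open>N = 2\<^sup>n\<close> and call \<open>(x, y, z)\<close> a defect triple of \<open>g\<close> if
  \<open>g x + g y + g z + g (x + y + z) \<noteq> 0\<close>; a permutation \<open>f\<close> has 24 defect triples for each 2-flat it breaks.
  A nonzero vector is orthogonal to exactly half of all vectors \<open>a\<close>, so the number of defect triples of \<open>f\<close> is
  \<open>2 / N\<close> times the sum of the numbers for the components \<open>\<langle>a, f\<rangle>\<close>. The \<open>a\<close> with affine component
  form a proper subspace, hence at least \<open>N / 2\<close> components are not affine, and it suffices to show
  that a non-affine Boolean function \<open>g\<close> of even weight has at least \<open>8 (N - 2) (N - 4)\<close> defect triples.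
  The distance of \<open>g\<close> to every affine function is even and positive. If it is 2 for some affine function,
  the number is exactly this. Otherwise all Fourier coefficients of \<open>(-1)\<^sup>g\<close> are at most \<open>N - 8\<close> in
  absolute value, and \<open>\<Sum> W\<^sup>4 \<le> max W\<^sup>2 \<cdot> \<Sum> W\<^sup>2\<close> gives at least \<open>8 N (N - 4)\<close>.
  In the equality case \<open>f\<close> differs from an affine map by a constant vector on two points, so it is an
  affine permutation composed with a transposition.\<close>

text \<open>By default the simplifier turns sums and products of bits into bit operations, which hides
  them from the ring lemmas.\<close>

declare add_bit_eq_xor [simp del] mult_bit_eq_and [simp del] CARD_vec [simp del]

section \<open>Arithmetic in characteristic two\<close>

lemma bit_add_self [simp]: "b + b = (0 :: bit)"
  by (cases b) simp_all

lemma bit_vec_add_self [simp]: "x + x = (0 :: bit ^ 'n)"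
  by (simp add: vec_eq_iff)

lemma bit_vec_add_left_self [simp]: "x + (x + y) = (y :: bit ^ 'n)"
  by (simp add: add.assoc[symmetric])

lemma bit_vec_add_eq_0_iff: "x + y = 0 \<longleftrightarrow> x = (y :: bit ^ 'n)"
  by (metis add.right_neutral bit_vec_add_left_self bit_vec_add_self)

lemma bit_vec_add_eq_iff: "x + u = y \<longleftrightarrow> x = y + (u :: bit ^ 'n)"
  by (auto simp: add.assoc)

lemma card_bit [simp]: "CARD(bit) = 2"
proof -
  have "(UNIV :: bit set) = {0, 1}"
    by (auto intro: bit_not_one_iff[THEN iffD1])
  then show ?thesis by (metis card_2_iff zero_neq_one)
qed

lemma card_bit_vec: "CARD(bit ^ 'n) = 2 ^ CARD('n)"
  by (simp add: CARD_vec)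

lemma sum_translate: "(\<Sum>x\<in>UNIV. g (x + c)) = (\<Sum>x\<in>UNIV. g (x :: bit ^ 'n))"
  by (rule sum.reindex_bij_witness[of _ "\<lambda>x. x + c" "\<lambda>x. x + c"]) (auto simp: add.assoc)

section \<open>The standard bilinear form\<close>

definition dot :: "bit ^ 'n \<Rightarrow> bit ^ 'n \<Rightarrow> bit" where
  "dot a x = (\<Sum>i\<in>UNIV. a $ i * x $ i)"

lemma dot_commute: "dot a x = dot x a"
  by (simp add: dot_def mult.commute)

lemma dot_add_right: "dot a (x + y) = dot a x + dot a y"
  by (simp add: dot_def distrib_left sum.distrib)

lemma dot_add_left: "dot (a + b) x = dot a x + dot b x"
  by (simp add: dot_def distrib_right sum.distrib)

lemma dot_0_right [simp]: "dot a 0 = 0"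
  by (simp add: dot_def)

lemma dot_0_left [simp]: "dot 0 x = 0"
  by (simp add: dot_def)

lemma dot_axis [simp]: "dot (axis k 1) x = x $ k"
proof -
  have "dot (axis k 1) x = (\<Sum>i\<in>UNIV. if i = k then x $ i else 0)"
    unfolding dot_def by (rule sum.cong) (auto simp: axis_def)
  then show ?thesis by simp
qed

text \<open>Translating \<open>a\<close> by a unit vector in the support of \<open>s\<close> flips
  \<open>dot a s\<close>, so the two fibres have equal size.\<close>

lemma card_dot_eq_1:
  fixes s :: "bit ^ 'n"
  assumes "s \<noteq> 0"
  shows "2 * card {a. dot a s = 1} = CARD(bit ^ 'n)"
proof -
  obtain k where k: "s $ k = 1"
    using assms by (auto simp: vec_eq_iff)
  have "card {a. dot a s = 1} = card {a. dot a s = 0}"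
    by (rule bij_betw_same_card[where f = "\<lambda>a. a + axis k 1"],
        rule bij_betwI[where g = "\<lambda>a. a + axis k 1"])
      (auto simp: dot_add_left k add.assoc)
  moreover have "CARD(bit ^ 'n) = card ({a. dot a s = 1} \<union> {a. dot a s = 0})"
    by (rule arg_cong[of _ _ card]) auto
  moreover have "\<dots> = card {a. dot a s = 1} + card {a. dot a s = 0}"
    by (rule card_Un_disjoint) auto
  ultimately show ?thesis by simp
qed

section \<open>Fourier transform and autocorrelation\<close>

text \<open>The nontrivial character (-1)^b, with integer values so that sums of signs
  count.\<close>

definition sign_bit :: "bit \<Rightarrow> int" where
  "sign_bit b = (if b = 0 then 1 else - 1)"

lemma sign_bit_add: "sign_bit (a + b) = sign_bit a * sign_bit b"
  by (cases a; cases b) (auto simp: sign_bit_def)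

lemma sign_bit_power2 [simp]: "(sign_bit b)\<^sup>2 = 1"
  by (simp add: sign_bit_def)

lemma sum_sign_bit:
  assumes "finite S"
  shows "(\<Sum>x\<in>S. sign_bit (g x)) = int (card S) - 2 * int (card {x\<in>S. g x = 1})"
proof -
  have "(\<Sum>x\<in>S. sign_bit (g x)) = (\<Sum>x\<in>S. 1 - 2 * (if g x = 1 then 1 else 0))"
    by (rule sum.cong) (auto simp: sign_bit_def)
  also have "\<dots> = int (card S) - 2 * (\<Sum>x\<in>S. if g x = 1 then 1 else 0)"
    by (simp add: sum_subtractf sum_distrib_left)
  also have "(\<Sum>x\<in>S. if g x = 1 then 1 else 0) = int (card {x\<in>S. g x = 1})"
    using assms by (simp flip: sum.inter_filter)
  finally show ?thesis .
qed

lemma sum_sign_bit_dot: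
  fixes x :: "bit ^ 'n"
  shows "(\<Sum>a\<in>UNIV. sign_bit (dot a x)) = (if x = 0 then int CARD(bit ^ 'n) else 0)"
  using card_dot_eq_1[of x] by (auto simp: sum_sign_bit simp flip: of_nat_mult)

definition fourier :: "(bit ^ 'n \<Rightarrow> int) \<Rightarrow> bit ^ 'n \<Rightarrow> int" where
  "fourier F a = (\<Sum>x\<in>UNIV. F x * sign_bit (dot a x))"

definition autocorrelation :: "(bit ^ 'n \<Rightarrow> int) \<Rightarrow> bit ^ 'n \<Rightarrow> int" where
  "autocorrelation F u = (\<Sum>x\<in>UNIV. F x * F (x + u))"

text \<open>Orthogonality of characters. An arbitrary integer-valued \<open>F\<close> is allowed
  because the identity is needed both for a sign function and for its autocorrelation.\<close>

lemma parseval: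
  fixes F :: "bit ^ 'n \<Rightarrow> int"
  shows "(\<Sum>a\<in>UNIV. (fourier F a)\<^sup>2) = int CARD(bit ^ 'n) * (\<Sum>x\<in>UNIV. (F x)\<^sup>2)"
proof -
  have "(\<Sum>a\<in>UNIV. (fourier F a)\<^sup>2) =
      (\<Sum>a\<in>UNIV. \<Sum>x\<in>UNIV. \<Sum>y\<in>UNIV. F x * F y * sign_bit (dot a (x + y)))"
    by (simp add: fourier_def power2_eq_square sum_product sign_bit_add dot_add_right mult_ac)
  also have "\<dots> = (\<Sum>x\<in>UNIV. \<Sum>a\<in>UNIV. \<Sum>y\<in>UNIV. F x * F y * sign_bit (dot a (x + y)))"
    by (rule sum.swap)
  also have "\<dots> = (\<Sum>x\<in>UNIV. \<Sum>y\<in>UNIV. \<Sum>a\<in>UNIV. F x * F y * sign_bit (dot a (x + y)))"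
    by (intro sum.cong refl sum.swap)
  also have "\<dots> = (\<Sum>x\<in>UNIV. \<Sum>y\<in>UNIV. if x = y then F x * F y * int CARD(bit ^ 'n) else 0)"
    by (simp add: sum_distrib_left[symmetric] sum_sign_bit_dot bit_vec_add_eq_0_iff if_distrib
        cong: if_cong)
  also have "\<dots> = int CARD(bit ^ 'n) * (\<Sum>x\<in>UNIV. (F x)\<^sup>2)"
    by (simp add: sum_distrib_left power2_eq_square mult_ac)
  finally show ?thesis .
qed

text \<open>As x = -x here, the autocorrelation is the convolution of \<open>F\<close> with itself;
  shifting \<open>u\<close> by \<open>x\<close> separates the double sum.\<close>

lemma fourier_autocorrelation: "fourier (autocorrelation F) a = (fourier F a)\<^sup>2"
proof -
  have "fourier (autocorrelation F) a =
      (\<Sum>u\<in>UNIV. \<Sum>x\<in>UNIV. F x * F (x + u) * sign_bit (dot a u))"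
    by (simp add: fourier_def autocorrelation_def sum_distrib_right)
  also have "\<dots> = (\<Sum>x\<in>UNIV. \<Sum>u\<in>UNIV. F x * F (u + x) * sign_bit (dot a u))"
    by (subst sum.swap) (simp add: add.commute)
  also have "\<dots> = (\<Sum>x\<in>UNIV. \<Sum>u\<in>UNIV. F x * F u * sign_bit (dot a (u + x)))"
  proof (rule sum.cong[OF refl])
    fix x
    show "(\<Sum>u\<in>UNIV. F x * F (u + x) * sign_bit (dot a u)) =
        (\<Sum>u\<in>UNIV. F x * F u * sign_bit (dot a (u + x)))"
      by (subst sum_translate[symmetric, of _ x]) (simp add: add.assoc)
  qed
  also have "\<dots> = (fourier F a)\<^sup>2"
    by (simp add: fourier_def power2_eq_square sum_product sign_bit_add dot_add_right mult_ac)
  finally show ?thesis .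
qed

text \<open>Squaring gives products over x, y, x + u, y + u, four points with sum zero; put z = x +
  u.\<close>

lemma sum_autocorrelation_power2:
  fixes F :: "bit ^ 'n \<Rightarrow> int"
  shows "(\<Sum>u\<in>UNIV. (autocorrelation F u)\<^sup>2) =
    (\<Sum>(x, y, z)\<in>UNIV. F x * F y * F z * F (x + y + z))"
proof -
  have "(\<Sum>u\<in>UNIV. (autocorrelation F u)\<^sup>2) =
      (\<Sum>u\<in>UNIV. \<Sum>x\<in>UNIV. \<Sum>y\<in>UNIV. F x * F y * F (u + x) * F (y + u))"
    by (simp add: autocorrelation_def power2_eq_square sum_product mult_ac add_ac)
  also have "\<dots> = (\<Sum>x\<in>UNIV. \<Sum>u\<in>UNIV. \<Sum>y\<in>UNIV. F x * F y * F (u + x) * F (y + u))"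
    by (rule sum.swap)
  also have "\<dots> = (\<Sum>x\<in>UNIV. \<Sum>y\<in>UNIV. \<Sum>u\<in>UNIV. F x * F y * F (u + x) * F (y + u))"
    by (intro sum.cong refl sum.swap)
  also have "\<dots> = (\<Sum>x\<in>UNIV. \<Sum>y\<in>UNIV. \<Sum>z\<in>UNIV. F x * F y * F z * F (x + y + z))"
  proof (rule sum.cong[OF refl], rule sum.cong[OF refl])
    fix x y :: "bit ^ 'n"
    show "(\<Sum>u\<in>UNIV. F x * F y * F (u + x) * F (y + u)) =
        (\<Sum>z\<in>UNIV. F x * F y * F z * F (x + y + z))"
      by (subst sum_translate[symmetric, of _ x]) (simp add: add_ac)
  qed
  finally show ?thesis
    by (simp add: sum.cartesian_product UNIV_Times_UNIV[symmetric] del: UNIV_Times_UNIV)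
qed

section \<open>Defect triples of scalar functions\<close>

definition defect :: "(bit ^ 'n \<Rightarrow> 'b :: ab_group_add) \<Rightarrow> bit ^ 'n \<Rightarrow> bit ^ 'n \<Rightarrow> bit ^ 'n \<Rightarrow> 'b" where
  "defect g x y z = g x + g y + g z + g (x + y + z)"

text \<open>Ordered triples with possible repetitions make the count a character sum over the whole
  cube; for values of characteristic two, repetitions add nothing, since their terms cancel.\<close>

definition defect_triples ::
    "(bit ^ 'n \<Rightarrow> 'b :: ab_group_add) \<Rightarrow> ((bit ^ 'n) \<times> (bit ^ 'n) \<times> (bit ^ 'n)) set" where
  "defect_triples g = {(x, y, z). defect g x y z \<noteq> 0}"

definition affine_map :: "(bit ^ 'n \<Rightarrow> 'b :: ab_group_add) \<Rightarrow> bool" where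
  "affine_map g \<longleftrightarrow> (\<forall>x y z. defect g x y z = 0)"

lemma defect_add: "defect (\<lambda>x. g x + h x) x y z = defect g x y z + defect h x y z"
  by (simp add: defect_def)

lemma defect_dot: "defect (\<lambda>x. dot a (f x)) x y z = dot a (defect f x y z)"
  by (simp add: defect_def dot_add_right)

lemma affine_map_dot_add_const: "affine_map (\<lambda>x. dot a x + c)"
  by (cases c) (auto simp: affine_map_def defect_def dot_add_right add_ac)

lemma defect_triples_add_affine:
  "affine_map h \<Longrightarrow> defect_triples (\<lambda>x. h x + g x) = defect_triples g"
  by (simp add: defect_triples_def affine_map_def defect_add)

text \<open>Each of the N^3 triples contributes the sign of its defect: -1 for a defect triple, 1
  otherwise.\<close>

lemma sum_autocorrelation_sign_bit:
  fixes g :: "bit ^ 'n \<Rightarrow> bit"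
  shows "(\<Sum>u\<in>UNIV. (autocorrelation (\<lambda>x. sign_bit (g x)) u)\<^sup>2) =
    int CARD(bit ^ 'n) ^ 3 - 2 * int (card (defect_triples g))"
proof -
  have "(\<Sum>u\<in>UNIV. (autocorrelation (\<lambda>x. sign_bit (g x)) u)\<^sup>2) =
      (\<Sum>t\<in>UNIV. sign_bit (case t of (x, y, z) \<Rightarrow> defect g x y z))"
    unfolding sum_autocorrelation_power2
    by (rule sum.cong) (auto simp: defect_def sign_bit_add)
  also have "\<dots> = int CARD((bit ^ 'n) \<times> (bit ^ 'n) \<times> (bit ^ 'n)) -
      2 * int (card {t. (case t of (x, y, z) \<Rightarrow> defect g x y z) = 1})"
    by (subst sum_sign_bit) simp_all
  also have "{t. (case t of (x, y, z) \<Rightarrow> defect g x y z) = 1} = defect_triples g"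
    by (auto simp: defect_triples_def)
  finally show ?thesis
    by (simp add: power3_eq_cube mult_ac)
qed

section \<open>Functions of weight two\<close>

definition pair_bit :: "'a \<Rightarrow> 'a \<Rightarrow> 'a \<Rightarrow> bit" where
  "pair_bit p q x = (if x = p \<or> x = q then 1 else 0)"

text \<open>The value is N minus twice the size of the symmetric difference of {p, q} and its
  translate by \<open>u\<close>. These sets coincide for the two exceptional \<open>u\<close> and
  are disjoint for every other one.\<close>

lemma autocorrelation_sign_pair_bit:
  fixes p q :: "bit ^ 'n"
  assumes "p \<noteq> q"
  shows "autocorrelation (\<lambda>x. sign_bit (pair_bit p q x)) u =
    (if u = 0 \<or> u = p + q then int CARD(bit ^ 'n) else int CARD(bit ^ 'n) - 8)"
proof -
  have "autocorrelation (\<lambda>x. sign_bit (pair_bit p q x)) u =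
      int CARD(bit ^ 'n) - 2 * int (card {x. pair_bit p q x + pair_bit p q (x + u) = 1})"
    by (simp add: autocorrelation_def sum_sign_bit flip: sign_bit_add)
  also have "card {x. pair_bit p q x + pair_bit p q (x + u) = 1} =
      (if u = 0 \<or> u = p + q then 0 else 4)"
  proof (cases "u = 0 \<or> u = p + q")
    case True
    have "p + (p + q) = q" "q + (p + q) = p"
      by (simp_all add: add.left_commute[of q])
    then have "p + u = p \<and> q + u = q \<or> p + u = q \<and> q + u = p"
      using True by fastforce
    then have "pair_bit p q (x + u) = pair_bit p q x" for x
      unfolding pair_bit_def bit_vec_add_eq_iff[of x u] by (elim disjE conjE) (simp_all only: disj_commute)
    then show ?thesis using True by simp
  next
    case False
    have "u = p + q" if "p + u = q \<or> q + u = p"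
      using that bit_vec_add_left_self[of p u] bit_vec_add_left_self[of q u] add.commute[of p q]
      by metis
    then have ne: "p \<noteq> p + u" "q \<noteq> q + u" "p \<noteq> q + u" "q \<noteq> p + u" "p + u \<noteq> q + u"
      using False assms by auto
    have "{x. pair_bit p q x + pair_bit p q (x + u) = 1} = {p, q, p + u, q + u}"
      using ne by (auto simp: pair_bit_def bit_vec_add_eq_iff[of _ u] split: if_splits)
    then show ?thesis using False assms ne by simp
  qed
  finally show ?thesis by simp
qed

text \<open>Two shifts contribute N^2 and the other N - 2 contribute (N - 8)^2, so twice the count
  is (N - 2)(N^2 - (N - 8)^2).\<close>

lemma card_defect_triples_pair_bit:
  fixes p q :: "bit ^ 'n"
  assumes "p \<noteq> q"
  shows "int (card (defect_triples (pair_bit p q))) =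
    8 * (int CARD(bit ^ 'n) - 2) * (int CARD(bit ^ 'n) - 4)"
proof -
  let ?N = "int CARD(bit ^ 'n)"
  let ?S = "{0, p + q} :: (bit ^ 'n) set"
  have S: "card ?S = 2"
    using assms by (simp add: bit_vec_add_eq_0_iff eq_commute[of 0])
  have "?N ^ 3 - 2 * int (card (defect_triples (pair_bit p q))) =
      (\<Sum>u\<in>UNIV. (if u \<in> ?S then ?N else ?N - 8)\<^sup>2)"
    unfolding sum_autocorrelation_sign_bit[symmetric] autocorrelation_sign_pair_bit[OF assms]
    by simp
  also have "\<dots> = (\<Sum>u\<in>UNIV. (?N - 8)\<^sup>2 + (if u \<in> ?S then ?N\<^sup>2 - (?N - 8)\<^sup>2 else 0))"
    by (intro sum.cong) auto
  also have "\<dots> = ?N * (?N - 8)\<^sup>2 + 2 * (?N\<^sup>2 - (?N - 8)\<^sup>2)"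
    using S by (simp only: sum.distrib sum.If_cases finite_code) (simp del: insert_iff)
  finally show ?thesis
    by (simp add: power2_eq_square power3_eq_cube algebra_simps)
qed

lemma card_defect_triples_far_from_affine:
  fixes g :: "bit ^ 'n \<Rightarrow> bit"
  assumes "\<And>a c. 4 \<le> card {x. g x \<noteq> dot a x + c}"
  shows "8 * int CARD(bit ^ 'n) * (int CARD(bit ^ 'n) - 4) \<le> int (card (defect_triples g))"
proof -
  let ?N = "int CARD(bit ^ 'n)"
  let ?F = "\<lambda>x. sign_bit (g x)"
  \<comment> \<open>The coefficient is N - 2d with d the distance to \<open>dot a\<close>. The
    distance to the complement \<open>dot a + 1\<close> is N - d, so the hypothesis gives 4 \<le> d
    \<le> N - 4.\<close>
  have fourier_le: "\<bar>fourier ?F a\<bar> \<le> ?N - 8" for a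
  proof -
    have eq: "fourier ?F a = ?N - 2 * int (card {x. g x + dot a x = 1})"
      by (simp add: fourier_def sum_sign_bit flip: sign_bit_add)
    have "{x. g x + dot a x = 1} = {x. g x \<noteq> dot a x + 0}"
      "{x. g x + dot a x = 0} = {x. g x \<noteq> dot a x + 1}"
      by (auto, (metis bit.exhaust bit_add_self add_0_right add_0)+)
    then have ge: "4 \<le> card {x. g x + dot a x = 1}" "4 \<le> card {x. g x + dot a x = 0}"
      using assms by metis+
    have "CARD(bit ^ 'n) = card ({x. g x + dot a x = 1} \<union> {x. g x + dot a x = 0})"
      by (rule arg_cong[of _ _ card]) auto
    also have "\<dots> = card {x. g x + dot a x = 1} + card {x. g x + dot a x = 0}"
      by (rule card_Un_disjoint) auto
    finally show ?thesis
      using eq ge by linarith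
  qed
  \<comment> \<open>Parseval for the autocorrelation produces the fourth moment of the coefficients;
    below, Parseval for the signs evaluates the remaining second moment.\<close>
  have "?N * (\<Sum>u\<in>UNIV. (autocorrelation ?F u)\<^sup>2) = (\<Sum>a\<in>UNIV. (fourier ?F a)\<^sup>2 * (fourier ?F a)\<^sup>2)"
    unfolding parseval[symmetric] fourier_autocorrelation by (simp add: power2_eq_square)
  also have "\<dots> \<le> (\<Sum>a\<in>UNIV. (?N - 8)\<^sup>2 * (fourier ?F a)\<^sup>2)"
    by (intro sum_mono mult_right_mono)
      (auto simp: abs_le_square_iff[symmetric] intro: order_trans[OF fourier_le])
  also have "\<dots> = ?N * ((?N - 8)\<^sup>2 * ?N)"
    by (simp add: sum_distrib_left[symmetric] parseval)
  finally have "(\<Sum>u\<in>UNIV. (autocorrelation ?F u)\<^sup>2) \<le> (?N - 8)\<^sup>2 * ?N"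
    by (simp add: mult_le_cancel_left)
  then show ?thesis
    unfolding sum_autocorrelation_sign_bit
    by (simp add: power2_eq_square power3_eq_cube algebra_simps)
qed

section \<open>Parity of the distance to affine functions\<close>

lemma bit_sum_eq_of_nat_card: "finite S \<Longrightarrow> (\<Sum>x\<in>S. g x) = (of_nat (card {x\<in>S. g x = 1}) :: bit)"
proof -
  assume "finite S"
  have "(\<Sum>x\<in>S. g x) = (\<Sum>x\<in>S. if g x = 1 then 1 else 0)"
    by (rule sum.cong) auto
  then show ?thesis
    using \<open>finite S\<close> by (simp flip: sum.inter_filter)
qed

lemma bit_of_nat_eq_0_iff: "of_nat k = (0 :: bit) \<longleftrightarrow> even k"
proof -
  have "b = 0 \<longleftrightarrow> even b" for b :: bit
    by (cases b) simp_all
  then show ?thesis by (simp only: even_of_nat)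
qed

lemma four_dvd_card_bit_vec: "2 \<le> CARD('n) \<Longrightarrow> 4 dvd CARD(bit ^ 'n)"
  using le_imp_power_dvd[of 2 "CARD('n)" "2 :: nat"] unfolding card_bit_vec by simp

text \<open>A nonzero form takes the value 1 exactly N / 2 times, an even number because 4 divides
  N.\<close>

lemma sum_dot:
  fixes a :: "bit ^ 'n"
  assumes "2 \<le> CARD('n)"
  shows "(\<Sum>x\<in>UNIV. dot a x) = 0"
proof (cases "a = 0")
  case False
  have "even (card {x. dot a x = 1})"
    using card_dot_eq_1[OF False] four_dvd_card_bit_vec[OF assms]
    by (auto simp: dot_commute[of a])
  then show ?thesis
    by (simp add: bit_sum_eq_of_nat_card bit_of_nat_eq_0_iff)
qed simp

text \<open>The parity of the distance is the sum of all values of the difference, and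
  \<open>g\<close>, the linear form and the constant each sum to zero.\<close>

lemma even_dist_affine:
  fixes g :: "bit ^ 'n \<Rightarrow> bit"
  assumes "2 \<le> CARD('n)" and "(\<Sum>x\<in>UNIV. g x) = 0"
  shows "even (card {x. g x \<noteq> dot a x + c})"
proof -
  have "{x. g x \<noteq> dot a x + c} = {x. g x + dot a x + c = 1}"
    by (auto, (metis (full_types) bit.exhaust bit_add_self add_0_right add_0 add.assoc)+)
  moreover have "(\<Sum>x\<in>UNIV. g x + dot a x + c) = 0"
  proof -
    have "even (CARD(bit ^ 'n))"
      using four_dvd_card_bit_vec[OF assms(1)] by auto
    then show ?thesis
      using assms by (simp add: sum.distrib sum_dot bit_of_nat_eq_0_iff)
  qed
  ultimately show ?thesis
    by (simp add: bit_sum_eq_of_nat_card bit_of_nat_eq_0_iff)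
qed

lemma eq_add_pair_bit:
  fixes g h :: "bit ^ 'n \<Rightarrow> bit"
  assumes "{x. g x \<noteq> h x} = {p, q}"
  shows "g = (\<lambda>x. h x + pair_bit p q x)"
proof
  fix x
  have "g x \<noteq> h x \<longleftrightarrow> x = p \<or> x = q"
    using assms by blast
  then show "g x = h x + pair_bit p q x"
    by (cases "g x"; cases "h x") (auto simp: pair_bit_def)
qed

lemma card_defect_triples_scalar:
  fixes g :: "bit ^ 'n \<Rightarrow> bit"
  assumes n: "3 \<le> CARD('n)" and even: "(\<Sum>x\<in>UNIV. g x) = 0" and "\<not> affine_map g"
  shows "int (card (defect_triples g)) \<ge> 8 * (int CARD(bit ^ 'n) - 2) * (int CARD(bit ^ 'n) - 4)"
    and "int (card (defect_triples g)) = 8 * (int CARD(bit ^ 'n) - 2) * (int CARD(bit ^ 'n) - 4) \<Longrightarrow>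
      \<exists>h p q. affine_map h \<and> p \<noteq> q \<and> g = (\<lambda>x. h x + pair_bit p q x)"
proof -
  let ?N = "int CARD(bit ^ 'n)"
  have "2 ^ 3 \<le> CARD(bit ^ 'n)"
    using n unfolding card_bit_vec by (intro power_increasing) auto
  then have N: "8 \<le> ?N" by simp
  \<comment> \<open>This dichotomy yields both claims: away from distance two the bound is
    strict.\<close>
  have *: "int (card (defect_triples g)) > 8 * (?N - 2) * (?N - 4) \<or>
    (int (card (defect_triples g)) = 8 * (?N - 2) * (?N - 4) \<and>
      (\<exists>h p q. affine_map h \<and> p \<noteq> q \<and> g = (\<lambda>x. h x + pair_bit p q x)))"
  proof (cases "\<forall>a c. 4 \<le> card {x. g x \<noteq> dot a x + c}")
    case True
    have "8 * (?N - 2) * (?N - 4) < 8 * ?N * (?N - 4)"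
      using N by simp
    then show ?thesis
      using card_defect_triples_far_from_affine[of g] True by fastforce
  next
    case False
    then obtain a c where "card {x. g x \<noteq> dot a x + c} < 4"
      by (auto simp: not_le)
    moreover have "card {x. g x \<noteq> dot a x + c} \<noteq> 0"
    proof
      assume "card {x. g x \<noteq> dot a x + c} = 0"
      then have "{x. g x \<noteq> dot a x + c} = {}"
        by simp
      then have "g = (\<lambda>x. dot a x + c)"
        by blast
      then show False
        using assms(3) affine_map_dot_add_const[of a c] by simp
    qed
    moreover have "even (card {x. g x \<noteq> dot a x + c})"
      using n even by (intro even_dist_affine) auto
    ultimately have "card {x. g x \<noteq> dot a x + c} = 2"
      by presburger
    then obtain p q where "{x. g x \<noteq> dot a x + c} = {p, q}" "p \<noteq> q"
      by (meson card_2_iff)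
    then have g: "g = (\<lambda>x. (dot a x + c) + pair_bit p q x)" and "p \<noteq> q"
      using eq_add_pair_bit[of g "\<lambda>x. dot a x + c" p q] by blast+
    moreover have "defect_triples g = defect_triples (pair_bit p q)"
      unfolding g by (rule defect_triples_add_affine[OF affine_map_dot_add_const])
    ultimately show ?thesis
      using affine_map_dot_add_const[of a c] card_defect_triples_pair_bit[of p q] by auto
  qed
  show "int (card (defect_triples g)) \<ge> 8 * (?N - 2) * (?N - 4)"
    using * by linarith
  show "\<exists>h p q. affine_map h \<and> p \<noteq> q \<and> g = (\<lambda>x. h x + pair_bit p q x)"
    if "int (card (defect_triples g)) = 8 * (?N - 2) * (?N - 4)"
    using * that by auto
qed

section \<open>Two-flats and defect triples\<close>

lemma span_pair_bit_vec:
  fixes u v :: "bit ^ 'n"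
  shows "vec.span {u, v} = {0, u, v, u + v}"
proof (rule subset_antisym)
  have scale: "k *s w \<in> {0, w}" for k and w :: "bit ^ 'n"
    by (cases k) auto
  have "vec.subspace {0, u, v, u + v}"
    using scale by (auto simp: vec.subspace_def add_ac)
  then show "vec.span {u, v} \<subseteq> {0, u, v, u + v}"
    by (intro vec.span_minimal) auto
  show "{0, u, v, u + v} \<subseteq> vec.span {u, v}"
    by (auto intro: vec.span_base vec.span_add vec.span_zero)
qed

text \<open>Four distinct points with sum zero are a, b, c, a + b + c, which is \<open>a\<close>
  plus the span of a + b and a + c.\<close>

lemma two_flat_iff: "two_flat X \<longleftrightarrow> card X = 4 \<and> \<Sum>X = (0 :: bit ^ 'n)"
proof
  assume "two_flat X"
  then obtain a V where V: "vec.subspace V" "vec.dim V = 2" "X = (\<lambda>v. a + v) ` V"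
    unfolding two_flat_def by blast
  obtain B where B: "B \<subseteq> V" "vec.independent B" "V \<subseteq> vec.span B" "card B = vec.dim V"
    using vec.basis_exists by blast
  then obtain u v where uv: "B = {u, v}" "u \<noteq> v"
    using V(2) by (metis card_2_iff)
  then have ne: "u \<noteq> 0" "v \<noteq> 0"
    using B(2) vec.dependent_zero by auto
  have "V = {0, u, v, u + v}"
    using B V(1) uv span_pair_bit_vec vec.span_minimal by (metis subset_antisym)
  then have "X = {a, a + u, a + v, a + (u + v)}"
    using V(3) by simp
  moreover have "a \<noteq> a + u" "a \<noteq> a + v" "a \<noteq> a + (u + v)" "a + u \<noteq> a + v"
      "a + u \<noteq> a + (u + v)" "a + v \<noteq> a + (u + v)"
    using ne uv(2) by (auto simp: bit_vec_add_eq_0_iff)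
  ultimately show "card X = 4 \<and> \<Sum>X = 0"
    by (simp add: add_ac)
next
  assume X: "card X = 4 \<and> \<Sum>X = 0"
  then obtain a Y where a: "X = insert a Y" "a \<notin> Y" "card Y = 3"
    by (metis card_Suc_eq eval_nat_numeral(2) semiring_norm(26) semiring_norm(27) numeral_3_eq_3)
  then obtain b c d where "Y = {b, c, d}" "b \<noteq> c" "b \<noteq> d" "c \<noteq> d"
    by (auto simp: card_3_iff)
  then have Xeq: "X = {a, b, c, d}" and dist: "a \<noteq> b" "a \<noteq> c" "a \<noteq> d" "b \<noteq> c" "b \<noteq> d" "c \<noteq> d"
    using a by auto
  then have "a + (b + (c + d)) = 0"
    using X by simp
  then have d: "d = a + b + c"
    by (metis add.assoc bit_vec_add_eq_0_iff)
  let ?B = "{a + b, a + c}"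
  have "a + b \<noteq> 0" "a + c \<noteq> 0" "a + b \<noteq> a + c"
    using dist by (auto simp: bit_vec_add_eq_0_iff)
  then have "vec.independent ?B"
    \<comment> \<open>With both vectors equal, the pair formula describes the line {0, a + c}, which
      must not contain a + b.\<close>
    using span_pair_bit_vec[of "a + c" "a + c"] by (simp add: vec.independent_insert)
  then have "vec.dim (vec.span ?B) = 2"
    using dist by (simp add: vec.dim_eq_card_independent)
  moreover have "X = (\<lambda>v. a + v) ` vec.span ?B"
    unfolding Xeq d span_pair_bit_vec by (auto simp: add_ac)
  ultimately show "two_flat X"
    unfolding two_flat_def using vec.subspace_span by blast
qed

lemma card_distinct_triples:
  assumes "card X = 4"
  shows "card {(x, y, z). {x, y, z} \<subseteq> X \<and> x \<noteq> y \<and> x \<noteq> z \<and> y \<noteq> z} = 24"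
proof -
  have fin: "finite X"
    using assms card.infinite by fastforce
  have "{(x, y, z). {x, y, z} \<subseteq> X \<and> x \<noteq> y \<and> x \<noteq> z \<and> y \<noteq> z} =
      Sigma X (\<lambda>x. Sigma (X - {x}) (\<lambda>y. X - {x, y}))"
    by auto
  also have "card \<dots> = (\<Sum>x\<in>X. \<Sum>y\<in>X - {x}. card (X - {x, y}))"
    using fin by simp
  also have "\<dots> = (\<Sum>x\<in>X. \<Sum>y\<in>X - {x}. 2)"
    using fin assms by (intro sum.cong refl) (auto simp: card_Diff_subset)
  also have "\<dots> = 24"
    using fin assms by simp
  finally show ?thesis .
qed

text \<open>Three distinct points of a flat force the fourth, so a triple lies in only one flat.
  This makes the triple sets of different flats disjoint.\<close>

lemma two_flat_triple_iff:
  fixes X :: "(bit ^ 'n) set"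
  assumes "two_flat X"
  shows "{x, y, z} \<subseteq> X \<and> x \<noteq> y \<and> x \<noteq> z \<and> y \<noteq> z \<longleftrightarrow>
    x \<noteq> y \<and> x \<noteq> z \<and> y \<noteq> z \<and> {x, y, z, x + y + z} = X"
proof
  assume L: "{x, y, z} \<subseteq> X \<and> x \<noteq> y \<and> x \<noteq> z \<and> y \<noteq> z"
  then have "card (X - {x, y, z}) = 1"
    using assms by (simp add: two_flat_iff card_Diff_subset)
  then obtain t where "X - {x, y, z} = {t}"
    by (auto simp: card_1_singleton_iff)
  then have X: "X = {x, y, z, t}" "t \<notin> {x, y, z}"
    using L by auto
  then have "x + (y + (z + t)) = 0"
    using assms L by (auto simp: two_flat_iff)
  then have "t = x + y + z"
    by (metis add.assoc bit_vec_add_eq_0_iff)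
  then show "x \<noteq> y \<and> x \<noteq> z \<and> y \<noteq> z \<and> {x, y, z, x + y + z} = X"
    using L X by simp
qed auto

lemma distinct_triple_sum:
  fixes x y z :: "bit ^ 'n"
  assumes "x \<noteq> y" "x \<noteq> z" "y \<noteq> z"
  shows "x + y + z \<notin> {x, y, z}"
proof -
  have "x + y + z = x + (y + z)" "x + y + z = y + (x + z)" "x + y + z = z + (x + y)"
    by (simp_all add: add_ac)
  then show ?thesis
    using assms bit_vec_add_eq_0_iff by (metis add_cancel_left_right insertE singletonD)
qed

lemma two_flat_triple:
  fixes x y z :: "bit ^ 'n"
  assumes "x \<noteq> y" "x \<noteq> z" "y \<noteq> z"
  shows "two_flat {x, y, z, x + y + z}"
proof -
  have "x + y + z \<noteq> x" "x + y + z \<noteq> y" "x + y + z \<noteq> z"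
    using distinct_triple_sum[OF assms] by blast+
  then have "card {x, y, z, x + y + z} = 4" "\<Sum>{x, y, z, x + y + z} = x + (y + (z + (x + y + z)))"
    using assms by (simp_all add: eq_commute[of _ "x + y + z"])
  then show ?thesis
    using bit_vec_add_self[of "x + y + z"] unfolding two_flat_iff by (simp only: add.assoc simp_thms)
qed

lemma two_flat_image_triple_iff:
  fixes x y z :: "bit ^ 'n" and f :: "bit ^ 'n \<Rightarrow> bit ^ 'n"
  assumes "inj f" "x \<noteq> y" "x \<noteq> z" "y \<noteq> z"
  shows "two_flat (f ` {x, y, z, x + y + z}) \<longleftrightarrow> defect f x y z = 0"
proof -
  have "x + y + z \<noteq> x" "x + y + z \<noteq> y" "x + y + z \<noteq> z"
    using distinct_triple_sum[OF assms(2-)] by blast+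
  then have "f x \<noteq> f (x + y + z)" "f y \<noteq> f (x + y + z)" "f z \<noteq> f (x + y + z)"
    "f x \<noteq> f y" "f x \<noteq> f z" "f y \<noteq> f z"
    using assms unfolding inj_eq[OF assms(1)] by auto
  then have "card (f ` {x, y, z, x + y + z}) = 4" "\<Sum>(f ` {x, y, z, x + y + z}) = defect f x y z"
    by (simp_all add: defect_def add.assoc)
  then show ?thesis
    by (simp only: two_flat_iff simp_thms)
qed

text \<open>A defect triple has distinct entries and completes to a unique broken flat; conversely
  all 4 * 3 * 2 ordered triples from a broken flat are defect triples.\<close>

lemma card_defect_triples_eq_two_coaffinity:
  fixes f :: "bit ^ 'n \<Rightarrow> bit ^ 'n"
  assumes "bij f"
  shows "card (defect_triples f) = 24 * two_coaffinity f"
proof -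
  let ?broken = "{X. two_flat X \<and> \<not> two_flat (f ` X)}"
  let ?T = "\<lambda>X. {(x, y, z). {x, y, z} \<subseteq> X \<and> x \<noteq> y \<and> x \<noteq> z \<and> y \<noteq> z}"
  have inj: "inj f"
    using assms by (rule bij_is_inj)
  have distinct: "x \<noteq> y \<and> x \<noteq> z \<and> y \<noteq> z" if "defect f x y z \<noteq> 0" for x y z
    using that by (auto simp: defect_def add_ac)
  have triples: "defect_triples f = (\<Union>X\<in>?broken. ?T X)"
  proof (intro subset_antisym subsetI)
    fix t assume "t \<in> defect_triples f"
    then obtain x y z where t: "t = (x, y, z)" "defect f x y z \<noteq> 0"
      by (auto simp: defect_triples_def)
    then show "t \<in> (\<Union>X\<in>?broken. ?T X)"
      using distinct[OF t(2)] two_flat_triple[of x y z] two_flat_image_triple_iff[OF inj, of x y z]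
      by (intro UN_I[of "{x, y, z, x + y + z}"]) auto
  next
    fix t assume "t \<in> (\<Union>X\<in>?broken. ?T X)"
    then obtain X x y z where t: "t = (x, y, z)" "two_flat X" "\<not> two_flat (f ` X)"
      "{x, y, z} \<subseteq> X \<and> x \<noteq> y \<and> x \<noteq> z \<and> y \<noteq> z"
      by blast
    then show "t \<in> defect_triples f"
      using two_flat_triple_iff[OF t(2), of x y z] two_flat_image_triple_iff[OF inj, of x y z]
      by (auto simp: defect_triples_def)
  qed
  have "card (defect_triples f) = (\<Sum>X\<in>?broken. card (?T X))"
    unfolding triples
  proof (rule card_UN_disjoint)
    show "\<forall>X\<in>?broken. \<forall>Y\<in>?broken. X \<noteq> Y \<longrightarrow> ?T X \<inter> ?T Y = {}"
    proof (intro ballI impI)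
      fix X Y assume XY: "X \<in> ?broken" "Y \<in> ?broken" "X \<noteq> Y"
      have "X = Y" if "t \<in> ?T X" "t \<in> ?T Y" for t
      proof -
        obtain x y z where "t = (x, y, z)" by (cases t)
        then show ?thesis
          using that XY two_flat_triple_iff[of X x y z] two_flat_triple_iff[of Y x y z] by simp
      qed
      then show "?T X \<inter> ?T Y = {}"
        using XY(3) by blast
    qed
  qed simp_all
  also have "\<dots> = (\<Sum>X\<in>?broken. 24)"
  proof (rule sum.cong[OF refl])
    fix X assume "X \<in> ?broken"
    then have "card X = 4"
      unfolding mem_Collect_eq two_flat_iff[of X] by blast
    then show "card (?T X) = 24"
      by (rule card_distinct_triples)
  qed
  finally show ?thesis
    by (simp add: two_coaffinity_def)
qed

section \<open>The affine group\<close>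

text \<open>Subtracting \<open>f 0\<close> leaves an additive map, by the defect at (x, y, 0).
  Additive maps are linear over the two-element field; the transpose appears because matrices act on
  row vectors.\<close>

lemma affine_map_bit_vec_iff:
  fixes f :: "bit ^ 'n \<Rightarrow> bit ^ 'm"
  shows "affine_map f \<longleftrightarrow> (\<exists>A b. f = (\<lambda>x. x v* A + b))"
proof
  assume f: "affine_map f"
  define L where "L x = f x + f 0" for x
  have add: "L (x + y) = L x + L y" for x y
    using f[unfolded affine_map_def defect_def, rule_format, of x y 0]
    by (simp add: L_def bit_vec_add_eq_0_iff add_ac)
  have "L (c *s x) = c *s L x" for c x
    by (cases c) (auto simp: L_def)
  with add have "Vector_Spaces.linear (*s) (*s) L"
    by (simp add: Vector_Spaces.linear_iff vec.vector_space_axioms)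
  then have "L x = x v* Finite_Cartesian_Product.transpose (matrix L)" for x
    by (simp add: matrix_works)
  then have "f x = x v* Finite_Cartesian_Product.transpose (matrix L) + f 0" for x
    unfolding L_def by (metis add.assoc add.right_neutral bit_vec_add_self)
  then show "\<exists>A b. f = (\<lambda>x. x v* A + b)"
    by blast
next
  assume "\<exists>A b. f = (\<lambda>x. x v* A + b)"
  then show "affine_map f"
    by (auto simp: affine_map_def defect_def vector_matrix_left_distrib add_ac)
qed

lemma invertible_iff_bij_vector_matrix:
  fixes A :: "bit ^ 'n ^ 'n"
  shows "invertible A \<longleftrightarrow> bij (\<lambda>x. x v* A + b)"
proof -
  have "bij (\<lambda>x. x v* A + b) \<longleftrightarrow> inj (\<lambda>x. x v* A + b)"
    by (metis bij_is_inj finite_UNIV_inj_surj finite bijI)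
  also have "\<dots> \<longleftrightarrow> inj ((*v) (Finite_Cartesian_Product.transpose A))"
    by (simp add: inj_def)
  also have "\<dots> \<longleftrightarrow> invertible (Finite_Cartesian_Product.transpose A)"
    by (metis invertible_left_inverse matrix_left_invertible_injective)
  also have "\<dots> \<longleftrightarrow> invertible A"
    by (simp add: invertible_det_nz det_transpose)
  finally show ?thesis by simp
qed

lemma AGL_iff: "f \<in> AGL \<longleftrightarrow> bij f \<and> affine_map f"
proof
  assume "f \<in> AGL"
  then obtain A b where "invertible A" "f = (\<lambda>x. x v* A + b)"
    unfolding AGL_def by blast
  then show "bij f \<and> affine_map f"
    using invertible_iff_bij_vector_matrix[of A b] affine_map_bit_vec_iff[of f] by blast
next
  assume f: "bij f \<and> affine_map f"
  then obtain A b where "f = (\<lambda>x. x v* A + b)"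
    unfolding affine_map_bit_vec_iff by blast
  then show "f \<in> AGL"
    using f invertible_iff_bij_vector_matrix[of A b] unfolding AGL_def by blast
qed

lemma affine_map_iff:
  fixes f :: "bit ^ 'n \<Rightarrow> bit ^ 'm"
  shows "affine_map f \<longleftrightarrow> (\<forall>x y z. f (x + y + z) = f x + f y + f z)"
proof -
  have "defect f x y z = 0 \<longleftrightarrow> f (x + y + z) = f x + f y + f z" for x y z
    unfolding defect_def bit_vec_add_eq_0_iff by (rule eq_commute)
  then show ?thesis
    unfolding affine_map_def by presburger
qed

lemma AGL_comp:
  assumes "f \<in> AGL" "g \<in> AGL"
  shows "f \<circ> g \<in> AGL"
proof -
  have "f (x + y + z) = f x + f y + f z" "g (x + y + z) = g x + g y + g z" for x y z
    using assms unfolding AGL_iff affine_map_iff by blast+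
  then have "affine_map (f \<circ> g)"
    unfolding affine_map_iff o_apply by presburger
  moreover have "bij (f \<circ> g)"
    using assms unfolding AGL_iff by (intro bij_comp) blast+
  ultimately show ?thesis
    unfolding AGL_iff by (rule conjI[rotated])
qed

lemma AGL_inv:
  assumes "f \<in> AGL"
  shows "inv f \<in> AGL"
proof -
  have bij: "bij f" and add: "\<And>x y z. f (x + y + z) = f x + f y + f z"
    using assms by (auto simp: AGL_iff affine_map_iff)
  have "inv f (x + y + z) = inv f x + inv f y + inv f z" for x y z
    using bij by (intro inv_f_eq) (simp_all add: add bij_is_inj bij_is_surj surj_f_inv_f)
  then show ?thesis
    using bij by (simp add: AGL_iff affine_map_iff bij_imp_bij_inv)
qed

text \<open>A transvection \<open>x \<mapsto> x + \<langle>c, x\<rangle>(u + v)\<close> with \<open>\<langle>c, u\<rangle> = \<langle>c, v\<rangle> = 1\<close> moves \<open>u\<close> to \<open>v\<close>.\<close>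

lemma AGL_two_transitive:
  fixes a b a' b' :: "bit ^ 'n"
  assumes "a \<noteq> b" "a' \<noteq> b'"
  obtains \<beta> where "\<beta> \<in> AGL" "\<beta> a = a'" "\<beta> b = b'"
proof -
  define u v where "u = a + b" and "v = a' + b'"
  have "u \<noteq> 0" "v \<noteq> 0"
    using assms by (auto simp: u_def v_def bit_vec_add_eq_0_iff)
  then obtain i j where ij: "u $ i = 1" "v $ j = 1"
    by (auto simp: vec_eq_iff)
  \<comment> \<open>If one of the coordinates \<open>i\<close>, \<open>j\<close> is 1 in both
    vectors, that coordinate form serves; otherwise the sum of the two forms does.\<close>
  have "\<exists>c. dot c u = 1 \<and> dot c v = 1"
  proof (cases "u $ j = 1 \<or> v $ i = 1")
    case True
    then show ?thesis using ij by (metis dot_axis)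
  next
    case False
    then have "dot (axis i 1 + axis j 1) u = 1 \<and> dot (axis i 1 + axis j 1) v = 1"
      using ij by (simp add: dot_add_left)
    then show ?thesis by blast
  qed
  then obtain c where c: "dot c u = 1" "dot c v = 1" by blast
  define L where "L x = x + dot c x *s (u + v)" for x
  define \<beta> where "\<beta> x = a' + L (x + a)" for x
  \<comment> \<open>The transvection is an involution since
    \<open>dot c (u + v) = 0\<close>.\<close>
  have "L (L x) = x" for x
    using c by (cases "dot c x") (auto simp: L_def dot_add_right add_ac)
  then have inv: "a + L (\<beta> x + a') = x" for x
    by (simp add: \<beta>_def add_ac)
  have "inj \<beta>"
    using inv by (metis injI)
  then have "bij \<beta>"
    by (simp add: bij_def finite_UNIV_inj_surj)
  moreover have L_add: "L (x + y) = L x + L y" for x y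
    by (simp add: L_def dot_add_right vec.scale_left_distrib add_ac)
  have "affine_map \<beta>"
    unfolding affine_map_iff by (simp add: \<beta>_def L_add add_ac)
  moreover have "\<beta> a = a'"
    by (simp add: \<beta>_def L_def)
  moreover have "L u = v"
    using c by (simp add: L_def)
  then have "\<beta> b = b'"
    by (simp add: \<beta>_def u_def v_def add_ac)
  ultimately show ?thesis
    using that by (simp add: AGL_iff)
qed

section \<open>Defect triples along the double coset of a transposition\<close>

lemma card_defect_triples_transposition:
  fixes c d :: "bit ^ 'n"
  assumes "c \<noteq> d"
  shows "int (card (defect_triples (Transposition.transpose c d))) =
    8 * (int CARD(bit ^ 'n) - 2) * (int CARD(bit ^ 'n) - 4)"
proof -
  let ?h = "\<lambda>x. pair_bit c d x *s (c + d)"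
  have "Transposition.transpose c d = (\<lambda>x. x + ?h x)"
    by (auto simp: fun_eq_iff transpose_def pair_bit_def add_ac)
  moreover have "affine_map (\<lambda>x :: bit ^ 'n. x)"
    by (simp add: affine_map_iff)
  ultimately have "defect_triples (Transposition.transpose c d) = defect_triples ?h"
    by (simp add: defect_triples_add_affine)
  also have "defect ?h x y z = defect (pair_bit c d) x y z *s (c + d)" for x y z
    by (simp only: defect_def vec.scale_left_distrib)
  then have "defect_triples ?h = defect_triples (pair_bit c d)"
    using assms by (auto simp: defect_triples_def bit_vec_add_eq_0_iff)
  finally show ?thesis
    using card_defect_triples_pair_bit[OF assms] by simp
qed

text \<open>The injective affine \<open>\<alpha>\<close> preserves and reflects the relation
  defining a zero defect, while \<open>\<beta>\<close> permutes the triples.\<close>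

lemma card_defect_triples_AGL_comp:
  fixes f :: "bit ^ 'n \<Rightarrow> bit ^ 'n"
  assumes "\<alpha> \<in> AGL" "\<beta> \<in> AGL"
  shows "card (defect_triples (\<alpha> \<circ> f \<circ> \<beta>)) = card (defect_triples f)"
proof -
  have inj: "inj \<alpha>" and bij: "bij \<beta>"
    using assms unfolding AGL_iff by (blast intro: bij_is_inj)+
  have \<alpha>: "\<alpha> (x + y + z) = \<alpha> x + \<alpha> y + \<alpha> z"
    and \<beta>: "\<beta> (x + y + z) = \<beta> x + \<beta> y + \<beta> z" for x y z
    using assms unfolding AGL_iff affine_map_iff by blast+
  have *: "defect (\<alpha> \<circ> f \<circ> \<beta>) x y z = 0 \<longleftrightarrow> defect f (\<beta> x) (\<beta> y) (\<beta> z) = 0" for x y z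
    unfolding defect_def o_apply \<alpha>[symmetric] \<beta> bit_vec_add_eq_0_iff inj_eq[OF inj] ..
  let ?\<beta>3 = "map_prod \<beta> (map_prod \<beta> \<beta>)"
  have "bij ?\<beta>3"
    unfolding bij_def using bij by (simp add: prod.inj_map map_prod_surj bij_is_inj bij_is_surj)
  moreover have "?\<beta>3 -` defect_triples f = defect_triples (\<alpha> \<circ> f \<circ> \<beta>)"
    by (auto simp: defect_triples_def *)
  ultimately show ?thesis
    by (metis bij_is_inj bij_is_surj card_vimage_inj top_greatest)
qed

section \<open>Permutations with few defect triples\<close>

lemma affine_map_add: "affine_map g \<Longrightarrow> affine_map h \<Longrightarrow> affine_map (\<lambda>x. g x + h x)"
  by (simp add: affine_map_def defect_add)

lemma affine_map_iff_components:
  "affine_map f \<longleftrightarrow> (\<forall>a. affine_map (\<lambda>x. dot a (f x)))"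
proof
  assume *: "\<forall>a. affine_map (\<lambda>x. dot a (f x))"
  show "affine_map f"
    unfolding affine_map_def
  proof (intro allI)
    fix x y z
    have "dot (axis i 1) (defect f x y z) = 0" for i
      using * by (simp add: affine_map_def defect_dot del: dot_axis)
    then show "defect f x y z = 0"
      by (simp add: vec_eq_iff)
  qed
qed (simp add: affine_map_def defect_dot)

text \<open>Reindexing by the permutation reduces this to a linear form. It supplies the even weight
  demanded in the scalar case.\<close>

lemma sum_dot_bij:
  fixes f :: "bit ^ 'n \<Rightarrow> bit ^ 'n"
  assumes "2 \<le> CARD('n)" "bij f"
  shows "(\<Sum>x\<in>UNIV. dot a (f x)) = 0"
  using sum.reindex_bij_betw[OF assms(2), of "dot a"] sum_dot[OF assms(1), of a] by simp

text \<open>Double counting of pairs of a vector \<open>a\<close> and a triple whose defect has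
  \<open>dot\<close> product 1 with \<open>a\<close>: every nonzero defect is detected by exactly N
  / 2 vectors.\<close>

lemma card_defect_triples_components:
  fixes f :: "bit ^ 'n \<Rightarrow> bit ^ 'n"
  shows "CARD(bit ^ 'n) * card (defect_triples f) =
    2 * (\<Sum>a\<in>UNIV. card (defect_triples (\<lambda>x. dot a (f x))))"
proof -
  let ?D = "\<lambda>t. case t of (x, y, z) \<Rightarrow> defect f x y z"
  have "defect_triples (\<lambda>x. dot a (f x)) = {t \<in> defect_triples f. dot a (?D t) = 1}" for a
    by (auto simp: defect_triples_def defect_dot simp del: bit_not_zero_iff) auto
  then have "(\<Sum>a\<in>UNIV. card (defect_triples (\<lambda>x. dot a (f x)))) =
      (\<Sum>a\<in>UNIV. card {t \<in> defect_triples f. dot a (?D t) = 1})"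
    by simp
  also have "\<dots> = (\<Sum>t\<in>defect_triples f. card {a \<in> UNIV. dot a (?D t) = 1})"
    by (rule sum_multicount_gen[symmetric]) auto
  also have "2 * \<dots> = (\<Sum>t\<in>defect_triples f. CARD(bit ^ 'n))"
    unfolding sum_distrib_left
    by (intro sum.cong refl) (auto simp: defect_triples_def card_dot_eq_1)
  finally show ?thesis by simp
qed

lemma eq_affine_comp_transpose:
  fixes f A :: "bit ^ 'n \<Rightarrow> bit ^ 'n"
  assumes n: "3 \<le> CARD('n)" and f: "bij f" "\<not> affine_map f" and A: "affine_map A"
    and eq: "\<And>x. f x = A x + pair_bit p q x *s e"
  shows "A \<in> AGL" and "f = A \<circ> Transposition.transpose p q"
proof -
  have "2 ^ 3 \<le> CARD(bit ^ 'n)"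
    using n unfolding card_bit_vec by (intro power_increasing) auto
  then have N: "8 \<le> CARD(bit ^ 'n)" by simp
  have off: "f x = A x" if "x \<noteq> p" "x \<noteq> q" for x
    using that by (simp add: eq pair_bit_def)
  have inj: "inj f"
    using f(1) by (rule bij_is_inj)
  have "inj A"
  proof (rule injI, rule ccontr)
    fix x y assume xy: "A x = A y" "x \<noteq> y"
    \<comment> \<open>If A x = A y, then \<open>A\<close> is invariant under translation by x + y.
      Since N exceeds 4, some \<open>z\<close> and its translate both avoid \<open>p\<close> and
      \<open>q\<close>; there \<open>f\<close> agrees with \<open>A\<close>, against injectivity of
      \<open>f\<close>.\<close>
    have "card {p, q, p + (x + y), q + (x + y)} \<le> 4"
      by (simp add: card_insert_if)
    then have "{p, q, p + (x + y), q + (x + y)} \<noteq> UNIV"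
      using N by auto
    then obtain z where z: "z \<notin> {p, q, p + (x + y), q + (x + y)}"
      by blast
    have "z + x + y \<noteq> p" "z + x + y \<noteq> q"
      using z by (auto simp: add_ac)
    moreover have "A (z + x + y) = A z"
      using A xy(1) unfolding affine_map_iff by (simp add: add.assoc)
    ultimately have "f (z + x + y) = f z"
      using z by (simp add: off)
    then have "z + (x + y) = z"
      using inj by (simp add: inj_eq add.assoc)
    then show False
      using xy(2) by (simp add: bit_vec_add_eq_0_iff)
  qed
  then have bij: "bij A"
    by (simp add: bij_def finite_UNIV_inj_surj)
  then show "A \<in> AGL"
    using A by (simp add: AGL_iff)
  have "e \<noteq> 0"
  proof
    assume "e = 0"
    then have "f = A" by (simp add: eq fun_eq_iff)
    then show False using A f(2) by simp
  qed
  \<comment> \<open>The preimage must be \<open>q\<close>: \<open>p\<close> is excluded by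
    \<open>e \<noteq> 0\<close>, and any other point would satisfy f y = A y = f p.\<close>
  obtain y where y: "f p = A y"
    using bij by (metis bij_pointE)
  have "y \<noteq> p"
    using y \<open>e \<noteq> 0\<close> by (auto simp: eq pair_bit_def)
  then have "y = q"
    using y off inj by (metis inj_eq)
  then have "A p + e = A q"
    using y by (simp add: eq pair_bit_def)
  then have "A q + e = A p"
    by (metis add.assoc add.right_neutral bit_vec_add_self)
  show "f = A \<circ> Transposition.transpose p q"
    using \<open>A p + e = A q\<close> \<open>A q + e = A p\<close>
    by (auto simp: fun_eq_iff eq pair_bit_def Transposition.transpose_def)
qed

lemma card_defect_triples_bij:
  fixes f :: "bit ^ 'n \<Rightarrow> bit ^ 'n"
  assumes n: "3 \<le> CARD('n)" and f: "bij f" "\<not> affine_map f"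
  defines "m \<equiv> 8 * (int CARD(bit ^ 'n) - 2) * (int CARD(bit ^ 'n) - 4)"
  shows "m \<le> int (card (defect_triples f))"
    and "int (card (defect_triples f)) = m \<Longrightarrow>
      \<exists>A\<in>AGL. \<exists>p q. p \<noteq> q \<and> f = A \<circ> Transposition.transpose p q"
proof -
  let ?N = "int CARD(bit ^ 'n)"
  define R where "R a = int (card (defect_triples (\<lambda>x. dot a (f x))))" for a
  define \<Lambda> where "\<Lambda> = {a. affine_map (\<lambda>x. dot a (f x))}"
  have "2 ^ 3 \<le> CARD(bit ^ 'n)"
    using n unfolding card_bit_vec by (intro power_increasing) auto
  then have "0 < ?N - 2" "0 < ?N - 4" by simp_all
  then have m: "0 < m" unfolding m_def by simp
  obtain c where c: "c \<notin> \<Lambda>"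
    using f(2) affine_map_iff_components[of f] by (auto simp: \<Lambda>_def)
  have add: "a + b \<in> \<Lambda>" if "a \<in> \<Lambda>" "b \<in> \<Lambda>" for a b
    using that affine_map_add by (fastforce simp: \<Lambda>_def dot_add_left)
  \<comment> \<open>\<open>\<Lambda>\<close> is closed under addition, so its translate by an
    outside element misses it; hence at least half of the components are not affine.\<close>
  have shift: "(\<lambda>a. a + c) ` \<Lambda> \<subseteq> - \<Lambda>"
  proof clarify
    fix a assume "a \<in> \<Lambda>" "a + c \<in> \<Lambda>"
    then have "a + (a + c) \<in> \<Lambda>" by (rule add)
    then show False using c by simp
  qed
  have card_shift: "card ((\<lambda>a. a + c) ` \<Lambda>) = card \<Lambda>"
    by (intro card_image inj_onI) simp
  then have "card \<Lambda> \<le> card (- \<Lambda>)"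
    using card_mono[OF _ shift] by simp
  moreover have sum_card: "card \<Lambda> + card (- \<Lambda>) = CARD(bit ^ 'n)"
    by (subst card_Un_disjoint[symmetric]) auto
  ultimately have half: "?N \<le> 2 * int (card (- \<Lambda>))"
    by simp
  have scalar_even: "(\<Sum>x\<in>UNIV. dot a (f x)) = 0" for a
    using n f(1) by (intro sum_dot_bij) auto
  have R_ge: "m \<le> R a" if "a \<notin> \<Lambda>" for a
    using card_defect_triples_scalar(1)[OF n scalar_even, of a] that
    by (simp add: R_def m_def \<Lambda>_def)
  have "?N * int (card (defect_triples f)) = 2 * (\<Sum>a\<in>UNIV. R a)"
    using arg_cong[OF card_defect_triples_components[of f], of int] by (simp add: R_def)
  also have "(\<Sum>a\<in>UNIV. R a) = (\<Sum>a\<in>- \<Lambda>. R a)"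
    by (rule sum.mono_neutral_right) (auto simp: R_def \<Lambda>_def affine_map_def defect_triples_def)
  finally have total: "?N * int (card (defect_triples f)) = 2 * (\<Sum>a\<in>- \<Lambda>. R a)" .
  have sum_ge: "int (card (- \<Lambda>)) * m \<le> (\<Sum>a\<in>- \<Lambda>. R a)"
    using sum_mono[of "- \<Lambda>" "\<lambda>_. m" R] R_ge by simp
  have half_m: "?N * m \<le> 2 * (int (card (- \<Lambda>)) * m)"
    using half m mult_right_mono[of ?N "2 * int (card (- \<Lambda>))" m] by simp
  have "?N * m \<le> ?N * int (card (defect_triples f))"
    using total sum_ge half_m by linarith
  then show "m \<le> int (card (defect_triples f))"
    by (simp add: mult_le_cancel_left)
  \<comment> \<open>Equality makes both estimates tight: \<open>\<Lambda>\<close> has index two,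
    with complement the translate by \<open>c\<close>, and every component outside it, in particular
    that of \<open>c\<close>, attains the scalar minimum.\<close>
  assume "int (card (defect_triples f)) = m"
  then have "2 * (\<Sum>a\<in>- \<Lambda>. R a) = ?N * m"
    using total by simp
  then have sum_eq: "(\<Sum>a\<in>- \<Lambda>. R a) = int (card (- \<Lambda>)) * m" and "?N * m = 2 * int (card (- \<Lambda>)) * m"
    using sum_ge half_m by linarith+
  then have "?N = 2 * int (card (- \<Lambda>))"
    using m by simp
  then have "(\<lambda>a. a + c) ` \<Lambda> = - \<Lambda>"
    using sum_card card_shift by (intro card_subset_eq shift) auto
  then have compl: "a + c \<in> \<Lambda>" if "a \<notin> \<Lambda>" for a
    using that by (force simp: add.assoc)
  have "(\<Sum>a\<in>- \<Lambda>. R a - m) = 0"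
    by (simp add: sum_subtractf sum_eq)
  then have "R c = m"
    using R_ge c by (subst (asm) sum_nonneg_eq_0_iff) auto
  then obtain h p q where h: "affine_map h" and "p \<noteq> q" and
    hc: "(\<lambda>x. dot c (f x)) = (\<lambda>x. h x + pair_bit p q x)"
    using card_defect_triples_scalar(2)[OF n scalar_even, of c] c
    by (auto simp: R_def m_def \<Lambda>_def)
  \<comment> \<open>A coordinate outside \<open>\<Lambda>\<close> differs from the component of
    \<open>c\<close> by an affine function, so it carries the same correction
    \<open>pair_bit p q\<close>; \<open>e\<close> marks exactly these coordinates.\<close>
  define e :: "bit ^ 'n" where "e = (\<chi> i. if axis i 1 \<in> \<Lambda> then 0 else 1)"
  define A where "A x = f x + pair_bit p q x *s e" for x
  have "affine_map (\<lambda>x. A x $ i)" for i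
  proof (cases "axis i 1 \<in> \<Lambda>")
    case True
    then show ?thesis by (simp add: A_def e_def \<Lambda>_def)
  next
    case False
    have "A x $ i = dot (axis i 1 + c) (f x) + h x" for x
      using fun_cong[OF hc, of x] False by (simp add: A_def e_def dot_add_left add_ac)
    then show ?thesis
      using compl[OF False] h affine_map_add by (simp add: \<Lambda>_def)
  qed
  then have "affine_map A"
    by (simp add: affine_map_def defect_def vec_eq_iff)
  moreover have "f x = A x + pair_bit p q x *s e" for x
    by (simp add: A_def add.assoc)
  ultimately show "\<exists>A\<in>AGL. \<exists>p q. p \<noteq> q \<and> f = A \<circ> Transposition.transpose p q"
    using eq_affine_comp_transpose[OF n f] \<open>p \<noteq> q\<close> by blast
qed

text \<open>An affine permutation taking \<open>p\<close>, \<open>q\<close> to the points swapped by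
  \<open>\<tau>\<close> conjugates one transposition into the other.\<close>

lemma comp_transpose_in_AGL_double_coset:
  assumes "A \<in> AGL" "p \<noteq> q" "is_transposition \<tau>"
  shows "A \<circ> Transposition.transpose p q \<in> AGL_double_coset \<tau>"
proof -
  obtain c d where \<tau>: "c \<noteq> d" "\<tau> = Transposition.transpose c d"
    using assms(3) by (auto simp: is_transposition_def)
  obtain \<beta> where \<beta>: "\<beta> \<in> AGL" "\<beta> p = c" "\<beta> q = d"
    using AGL_two_transitive[OF assms(2) \<tau>(1)] .
  then have bij: "bij \<beta>"
    by (simp add: AGL_iff)
  have "Transposition.transpose p q x = inv \<beta> (\<tau> (\<beta> x))" for x
    using \<beta> bij unfolding \<tau>(2)
    by (auto simp: Transposition.transpose_def bij_is_inj inv_f_f inj_eq[OF bij_is_inj])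
  then have "A \<circ> Transposition.transpose p q = (A \<circ> inv \<beta>) \<circ> \<tau> \<circ> \<beta>"
    by (simp add: fun_eq_iff)
  then show ?thesis
    using \<beta>(1) assms(1) AGL_comp AGL_inv unfolding AGL_double_coset_def by blast
qed

theorem theorem7p2:
  fixes f :: "bit ^ 'n \<Rightarrow> bit ^ 'n"
  assumes "3 \<le> CARD('n)"
    and "f \<in> Per - AGL"
  shows "real (two_coaffinity f) \<ge> 8 / 3 * (2 ^ (CARD('n) - 1) - 1) * (2 ^ (CARD('n) - 2) - 1) \<and>
    (\<forall>\<tau> :: bit ^ 'n \<Rightarrow> bit ^ 'n. is_transposition \<tau> \<longrightarrow>
      (real (two_coaffinity f) = 8 / 3 * (2 ^ (CARD('n) - 1) - 1) * (2 ^ (CARD('n) - 2) - 1)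
        \<longleftrightarrow> f \<in> AGL_double_coset \<tau>))"
proof -
  let ?b = "8 / 3 * (2 ^ (CARD('n) - 1) - 1) * (2 ^ (CARD('n) - 2) - 1) :: real"
  define m where "m = 8 * (int CARD(bit ^ 'n) - 2) * (int CARD(bit ^ 'n) - 4)"
  have f: "bij f" "\<not> affine_map f"
    using assms(2) by (auto simp: Per_def AGL_iff)
  \<comment> \<open>This removes the truncated subtraction from the exponents: N / 2 and N / 4
    become 2^(k + 1) and 2^k.\<close>
  obtain k where k: "CARD('n) = k + 2"
    using assms(1) by (metis add.commute le_Suc_ex numeral_3_eq_3 add_Suc_right add_2_eq_Suc')
  have b: "24 * ?b = real_of_int m"
    by (simp add: m_def card_bit_vec k field_simps)
  have R: "real_of_int (int (card (defect_triples f))) = 24 * real (two_coaffinity f)"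
    using card_defect_triples_eq_two_coaffinity[OF f(1)] by simp
  have ge: "?b \<le> real (two_coaffinity f)"
    using card_defect_triples_bij(1)[OF assms(1) f] b R unfolding m_def[symmetric] by linarith
  have eq: "real (two_coaffinity f) = ?b \<longleftrightarrow> int (card (defect_triples f)) = m"
    using b R by linarith
  have "int (card (defect_triples f)) = m \<longleftrightarrow> f \<in> AGL_double_coset \<tau>"
    if \<tau>: "is_transposition \<tau>" for \<tau>
  proof
    assume "int (card (defect_triples f)) = m"
    then show "f \<in> AGL_double_coset \<tau>"
      using card_defect_triples_bij(2)[OF assms(1) f] comp_transpose_in_AGL_double_coset[OF _ _ \<tau>]
      unfolding m_def by blast
  next
    assume "f \<in> AGL_double_coset \<tau>"
    then obtain \<alpha> \<beta> where "f = \<alpha> \<circ> \<tau> \<circ> \<beta>" "\<alpha> \<in> AGL" "\<beta> \<in> AGL"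
      by (auto simp: AGL_double_coset_def)
    moreover obtain c d where "c \<noteq> d" "\<tau> = Transposition.transpose c d"
      using \<tau> by (auto simp: is_transposition_def)
    ultimately show "int (card (defect_triples f)) = m"
      using card_defect_triples_AGL_comp[of \<alpha> \<beta> \<tau>] card_defect_triples_transposition[of c d]
      by (simp add: m_def)
  qed
  then show ?thesis
    using ge eq by blast
qed

end
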